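(* Let $0<\alpha<1$ and $\pi\in(0,1)$ with $Q_{\alpha,\pi}:=\frac{(1-\alpha)(1-\pi)}{\alpha\pi}>1$. Let $G$ be a distribution function with support on $(0,\infty)$ such that $\int e^{\lambda r^2}\,G(dr)<\infty$ for some $\lambda>0$, and let $L_G(\lambda)=\int e^{\lambda r}\,G(dr)$. Consider multiple $t$-tests of $H_i:\mu_i=0$ for normal distributions $N(\mu_i,\sigma_i)$ under the random effects model, with $n+1$ observations per null, and suppose that when $H_i$ is false, the ratio $r_i=\mu_i/\sigma_i$ is a random draw from the law of $sR$, where $R\sim G$ and $s>0$ is a scale parameter. Let $n_*=n_*(s)$ be the minimum value of $n$ in order to attain $\mathrm{pFDR}\le\alpha$. Then $$n_*\sim\frac1s\,L_G^{-1}(Q_{\alpha,\pi})\qquad\text{as } s\to0+ .$$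
   Context: $N(\mu,\sigma)$ is the normal distribution with mean $\mu$ and standard deviation $\sigma$. For each $i$, $Y_{i1},\dots,Y_{i,n+1}$ are iid $\sim N(\mu_i,\sigma_i)$ (given the parameters), samples for different $i$ are independent, and $H_i:\mu_i=0$ is tested using only $$T_i=\frac{\sqrt{n+1}\,\bar Y_i}{S_i},\quad \bar Y_i=\frac1{n+1}\sum_{j=1}^{n+1}Y_{ij},\quad S_i^2=\frac1n\sum_{j=1}^{n+1}(Y_{ij}-\bar Y_i)^2 .$$ Random effects model: with $\theta_i=0$ if $H_i$ is true and $\theta_i=1$ if $H_i$ is false, the pairs $(\theta_i,T_i)$ are independent, $\theta_i\sim\mathrm{Bernoulli}(\pi)$; given $\theta_i=0$, $T_i$ has the density $t_n$ of the $t$ distribution with $n$ degrees of freedom; given $\theta_i=1$, $T_i$ has density $p_1^{(n)}(x)=\int t_{n,\sqrt{n+1}\,sr}(x)\,G(dr)$, where $t_{n,\delta}$ is the density of the noncentral $t$ distribution with $n$ degrees of freedom and noncentrality parameter $\delta$. With $R$ the number of rejected nulls and $V$ the number of rejected true nulls, $\mathrm{pFDR}=E[V/R\mid R>0]$. The minimum attainable pFDR with parameter $n$ is $$\alpha_*(n)=\frac{1-\pi}{1-\pi+\pi\int L(n,sr)\,G(dr)},\qquad L(n,r)=\sup_x\frac{t_{n,\sqrt{n+1}\,r}(x)}{t_n(x)},$$ and $n_*=\min\{n\ge1:\alpha_*(n)\le\alpha\}$. $L_G^{-1}$ denotes the inverse of the strictly increasing function $L_G:[0,\infty)\to[1,\infty)$.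 *)

theory Defs
  imports "HOL-Probability.Probability"
begin

section \<open>Central and noncentral \<open>t\<close> densities\<close>

definition chi_square_density :: "nat \<Rightarrow> real \<Rightarrow> real" where
  "chi_square_density n v =
     (if 0 < v then v powr (real n / 2 - 1) * exp (- v / 2) / (2 powr (real n / 2) * Gamma (real n / 2))
      else 0)"

definition student_t_density :: "nat \<Rightarrow> real \<Rightarrow> real" where
  "student_t_density n x =
     Gamma ((real n + 1) / 2) / (sqrt (real n * pi) * Gamma (real n / 2))
       * (1 + x\<^sup>2 / real n) powr (- (real n + 1) / 2)"

text \<open>
  The noncentral \<open>t\<close> distribution is the law of \<open>(Z + \<delta>) / sqrt (V / n)\<close> with \<open>Z\<close> standard normal and
  \<open>V\<close> an independent chi-square variable with \<open>n\<close> degrees of freedom. Conditionally on \<open>V = v\<close> it is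
  normal, and the density below averages the conditional normal density over \<open>v\<close>. Since the supremum
  of a ratio of densities is taken below, it matters that this is the continuous version of the
  density.
\<close>

definition noncentral_t_density :: "nat \<Rightarrow> real \<Rightarrow> real \<Rightarrow> real" where
  "noncentral_t_density n \<delta> x =
     (LINT v|lborel. sqrt (v / real n) * std_normal_density (x * sqrt (v / real n) - \<delta>)
        * chi_square_density n v)"

lemma chi_square_density_nonneg: "0 \<le> chi_square_density n v"
proof -
  have "0 \<le> Gamma (real n / 2)" by (cases "n = 0") (auto intro!: less_imp_le Gamma_real_pos)
  thus ?thesis by (auto simp: chi_square_density_def)
qed

lemma chi_square_density_measurable [measurable]: "chi_square_density n \<in> borel_measurable borel"
  unfolding chi_square_density_def by measurable

lemma nn_integral_Gamma_kernel:
  assumes a: "0 < a" and b: "0 < b"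
  shows "(\<integral>\<^sup>+v. ennreal (indicator {0<..} v * (v powr (a - 1) * exp (- (b * v)))) \<partial>lborel)
           = ennreal (Gamma a / b powr a)"
proof -
  let ?f = "\<lambda>t::real. ennreal (indicator {0..} t * t powr (a - 1) / exp t)"
  have "ennreal (Gamma a) = (\<integral>\<^sup>+t. ?f t \<partial>lborel)"
    by (rule Gamma_conv_nn_integral_real[OF a])
  also have "\<dots> = ennreal b * (\<integral>\<^sup>+v. ?f (0 + b * v) \<partial>lborel)"
    using nn_integral_real_affine[of ?f b 0] b by simp
  also have "(\<integral>\<^sup>+v. ?f (0 + b * v) \<partial>lborel) = (\<integral>\<^sup>+v. ennreal (b powr (a - 1)) *
      ennreal (indicator {0<..} v * (v powr (a - 1) * exp (- (b * v)))) \<partial>lborel)"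
  proof (intro nn_integral_cong)
    fix v :: real
    show "?f (0 + b * v) = ennreal (b powr (a - 1)) *
      ennreal (indicator {0<..} v * (v powr (a - 1) * exp (- (b * v))))"
      using b by (cases v "0::real" rule: linorder_cases)
        (auto simp: ennreal_mult' [symmetric] powr_mult exp_minus field_simps
          mult_less_0_iff zero_le_mult_iff indicator_def)
  qed
  also have "\<dots> = ennreal (b powr (a - 1)) *
      (\<integral>\<^sup>+v. ennreal (indicator {0<..} v * (v powr (a - 1) * exp (- (b * v)))) \<partial>lborel)"
    by (rule nn_integral_cmult) measurable
  finally have *: "ennreal (Gamma a) = ennreal (b powr a) *
      (\<integral>\<^sup>+v. ennreal (indicator {0<..} v * (v powr (a - 1) * exp (- (b * v)))) \<partial>lborel)"
    using b by (simp add: mult.assoc [symmetric] ennreal_mult' [symmetric] powr_mult_base)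
  have "ennreal (Gamma a / b powr a) = ennreal (1 / b powr a) * ennreal (Gamma a)"
    using b by (simp add: ennreal_mult' [symmetric])
  also have "\<dots> = ennreal (1 / b powr a * b powr a) *
      (\<integral>\<^sup>+v. ennreal (indicator {0<..} v * (v powr (a - 1) * exp (- (b * v)))) \<partial>lborel)"
    using b by (subst *) (simp add: mult.assoc [symmetric] ennreal_mult' [symmetric])
  finally show ?thesis using b by simp
qed

lemma prob_space_chi_square:
  assumes "1 \<le> n"
  shows "prob_space (density lborel (chi_square_density n))"
proof
  have G: "0 < Gamma (real n / 2)" using assms by (intro Gamma_real_pos) simp
  let ?c = "1 / (2 powr (real n / 2) * Gamma (real n / 2))"
  have "emeasure (density lborel (chi_square_density n)) (space (density lborel (chi_square_density n)))
      = (\<integral>\<^sup>+v. ennreal ?c * ennreal (indicator {0<..} v * (v powr (real n / 2 - 1) * exp (- (1/2 * v)))) \<partial>lborel)"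
    using G by (auto simp: emeasure_density chi_square_density_def ennreal_mult' [symmetric]
        intro!: nn_integral_cong)
  also have "\<dots> = ennreal ?c *
      (\<integral>\<^sup>+v. ennreal (indicator {0<..} v * (v powr (real n / 2 - 1) * exp (- (1/2 * v)))) \<partial>lborel)"
    by (rule nn_integral_cmult) measurable
  also have "\<dots> = ennreal (?c * (Gamma (real n / 2) / (1/2) powr (real n / 2)))"
    using assms G by (subst nn_integral_Gamma_kernel) (auto simp: ennreal_mult' [symmetric])
  also have "?c * (Gamma (real n / 2) / (1/2) powr (real n / 2)) = 1"
    using G by (simp add: powr_divide field_simps)
  finally show "emeasure (density lborel (chi_square_density n))
      (space (density lborel (chi_square_density n))) = 1" by simp
qed

lemma noncentral_t_density_zero:
  assumes "1 \<le> n"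
  shows "noncentral_t_density n 0 x = student_t_density n x"
proof -
  let ?m = "real n"
  have n: "0 < ?m" using assms by simp
  have G: "0 < Gamma (?m / 2)" using n by (intro Gamma_real_pos) simp
  have G1: "0 < Gamma ((?m + 1) / 2)" using n by (intro Gamma_real_pos) simp
  define b where "b = (1 + x\<^sup>2 / ?m) / 2"
  have q: "0 < 1 + x\<^sup>2 / ?m" using n by (intro add_pos_nonneg) auto
  have b: "0 < b" using q by (simp add: b_def)
  define c where "c = 1 / (sqrt ?m * sqrt (2 * pi) * (2 powr (?m / 2) * Gamma (?m / 2)))"
  have c: "0 \<le> c" using G by (simp add: c_def)
  have f: "sqrt (v / ?m) * std_normal_density (x * sqrt (v / ?m) - 0) * chi_square_density n v
      = c * (indicator {0<..} v * (v powr ((?m + 1) / 2 - 1) * exp (- (b * v))))" (is "?f v = ?g v") for v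
  proof (cases "0 < v")
    case True
    have sq: "(x * sqrt (v / ?m))\<^sup>2 = x\<^sup>2 * v / ?m" using True n by (simp add: power_mult_distrib)
    have e: "exp (- (x * sqrt (v / ?m))\<^sup>2 / 2) * exp (- v / 2) = exp (- (b * v))"
      unfolding exp_add [symmetric] sq b_def using n
      by (intro arg_cong[where f = exp]) (simp add: field_simps)
    have p: "sqrt v * v powr (?m / 2 - 1) = v powr ((?m + 1) / 2 - 1)"
      using True by (simp add: powr_half_sqrt [symmetric] powr_add [symmetric] add_divide_distrib)
    have k: "sqrt (v / ?m) * std_normal_density (x * sqrt (v / ?m) - 0) * chi_square_density n v
      = c * ((sqrt v * v powr (?m / 2 - 1)) * (exp (- (x * sqrt (v / ?m))\<^sup>2 / 2) * exp (- v / 2)))"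
      unfolding std_normal_density_def chi_square_density_def c_def real_sqrt_divide using True by simp
    show ?thesis unfolding k e p using True by simp
  qed (simp add: chi_square_density_def)
  have "(\<integral>\<^sup>+v. ennreal (?f v) \<partial>lborel)
      = ennreal c * (\<integral>\<^sup>+v. ennreal (indicator {0<..} v * (v powr ((?m + 1) / 2 - 1) * exp (- (b * v)))) \<partial>lborel)"
    unfolding f using c by (subst nn_integral_cmult [symmetric]) (auto simp: ennreal_mult')
  also have "\<dots> = ennreal (c * (Gamma ((?m + 1) / 2) / b powr ((?m + 1) / 2)))"
    using n b by (subst nn_integral_Gamma_kernel) (auto simp: ennreal_mult'[OF c, symmetric])
  finally have I: "(\<integral>\<^sup>+v. ennreal (?f v) \<partial>lborel) = ennreal (c * (Gamma ((?m + 1) / 2) / b powr ((?m + 1) / 2)))" .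
  have "noncentral_t_density n 0 x = c * (Gamma ((?m + 1) / 2) / b powr ((?m + 1) / 2))"
  proof -
    have "0 \<le> ?f v" for v unfolding f using c by simp
    hence "integral\<^sup>L lborel ?f = enn2real (\<integral>\<^sup>+v. ennreal (?f v) \<partial>lborel)"
      by (intro integral_eq_nn_integral AE_I2) measurable
    thus ?thesis unfolding noncentral_t_density_def I using c G1 by simp
  qed
  also have "b powr ((?m + 1) / 2) = (1 + x\<^sup>2 / ?m) powr ((?m + 1) / 2) / (2 powr (?m / 2) * sqrt 2)"
  proof -
    have "2 powr ((?m + 1) / 2) = 2 powr (?m / 2) * sqrt 2"
      by (simp add: add_divide_distrib powr_add powr_half_sqrt)
    thus ?thesis unfolding b_def using q by (subst powr_divide) auto
  qed
  also have "c * (Gamma ((?m + 1) / 2) / \<dots>) = student_t_density n x"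
    unfolding c_def student_t_density_def using n G q
    by (simp add: powr_minus real_sqrt_mult minus_divide_left [symmetric] del: minus_add_distrib) (simp add: field_simps)
  finally show ?thesis .
qed

lemma noncentral_t_integrable:
  assumes "1 \<le> n"
  shows "integrable lborel (\<lambda>v. sqrt (v / real n) * std_normal_density (x * sqrt (v / real n) - \<delta>)
           * chi_square_density n v)" (is "integrable _ ?f")
proof -
  have n: "0 < real n" using assms by simp
  have "0 < student_t_density n 0"
    using n by (simp add: student_t_density_def Gamma_real_pos)
  hence ne: "noncentral_t_density n 0 0 \<noteq> 0" using noncentral_t_density_zero[OF assms] by simp
  let ?g = "\<lambda>v. sqrt (v / real n) * std_normal_density (0 * sqrt (v / real n) - 0) * chi_square_density n v"
  have "integrable lborel ?g"
    using ne not_integrable_integral_eq unfolding noncentral_t_density_def by blast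
  thus ?thesis
  proof (rule Bochner_Integration.integrable_bound)
    show "AE v in lborel. norm (?f v) \<le> norm (?g v)"
    proof (intro AE_I2)
      fix v :: real
      have "std_normal_density (x * sqrt (v / real n) - \<delta>) \<le> std_normal_density (0 * sqrt (v / real n) - 0)"
        by (simp add: std_normal_density_def divide_right_mono)
      thus "norm (?f v) \<le> norm (?g v)"
        by (auto simp: abs_mult chi_square_density_nonneg intro!: mult_mono)
    qed
  qed measurable
qed

lemma distr_noncentral_t:
  assumes "1 \<le> n"
  shows "distr (density lborel std_normal_density \<Otimes>\<^sub>M density lborel (chi_square_density n)) borel
             (\<lambda>(z, v). (z + \<delta>) / sqrt (v / real n))
           = density lborel (noncentral_t_density n \<delta>)" (is "distr (?N \<Otimes>\<^sub>M ?C) _ ?T = _")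
proof (rule measure_eqI)
  have n: "0 < real n" using assms by simp
  interpret N: prob_space ?N by (rule prob_space_normal_density) simp
  interpret C: prob_space ?C by (rule prob_space_chi_square[OF assms])
  interpret P: pair_prob_space ?N ?C ..
  let ?f = "\<lambda>x v. sqrt (v / real n) * std_normal_density (x * sqrt (v / real n) - \<delta>) * chi_square_density n v"
  have nn: "0 \<le> ?f x v" for x v
    using chi_square_density_nonneg[of n v] n by (cases "0 < v") (auto simp: chi_square_density_def)
  fix A assume "A \<in> sets (distr (?N \<Otimes>\<^sub>M ?C) borel ?T)"
  hence A [measurable]: "A \<in> sets borel" by simp
  have T [measurable]: "?T \<in> ?N \<Otimes>\<^sub>M ?C \<rightarrow>\<^sub>M borel" by measurable
  have "emeasure (distr (?N \<Otimes>\<^sub>M ?C) borel ?T) A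
      = (\<integral>\<^sup>+x. indicator A x \<partial>distr (?N \<Otimes>\<^sub>M ?C) borel ?T)" by simp
  also have "\<dots> = (\<integral>\<^sup>+p. indicator A (?T p) \<partial>(?N \<Otimes>\<^sub>M ?C))"
    by (rule nn_integral_distr[OF T]) measurable
  also have "\<dots> = (\<integral>\<^sup>+v. \<integral>\<^sup>+z. indicator A ((z + \<delta>) / sqrt (v / real n)) \<partial>?N \<partial>?C)"
    by (subst P.nn_integral_snd [symmetric]) (auto simp: case_prod_beta')
  also have "\<dots> = (\<integral>\<^sup>+v. ennreal (chi_square_density n v) *
      (\<integral>\<^sup>+z. ennreal (std_normal_density z) * indicator A ((z + \<delta>) / sqrt (v / real n)) \<partial>lborel) \<partial>lborel)"
    by (subst nn_integral_density, measurable, subst nn_integral_density) auto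
  also have "\<dots> = (\<integral>\<^sup>+v. \<integral>\<^sup>+x. ennreal (?f x v) * indicator A x \<partial>lborel \<partial>lborel)"
  proof (intro nn_integral_cong)
    fix v :: real
    show "ennreal (chi_square_density n v) *
        (\<integral>\<^sup>+z. ennreal (std_normal_density z) * indicator A ((z + \<delta>) / sqrt (v / real n)) \<partial>lborel)
        = (\<integral>\<^sup>+x. ennreal (?f x v) * indicator A x \<partial>lborel)"
    proof (cases "0 < v")
      case True
      define c where "c = sqrt (v / real n)"
      have c: "0 < c" using True n by (simp add: c_def)
      have "(\<integral>\<^sup>+z. ennreal (std_normal_density z) * indicator A ((z + \<delta>) / c) \<partial>lborel)
          = ennreal c * (\<integral>\<^sup>+x. ennreal (std_normal_density (- \<delta> + c * x)) * indicator A ((- \<delta> + c * x + \<delta>) / c) \<partial>lborel)"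
        using c by (subst nn_integral_real_affine[where c = c and t = "- \<delta>"]) auto
      also have "\<dots> = ennreal c * (\<integral>\<^sup>+x. ennreal (std_normal_density (x * c - \<delta>)) * indicator A x \<partial>lborel)"
        using c by (simp add: algebra_simps)
      finally have "ennreal (chi_square_density n v) *
          (\<integral>\<^sup>+z. ennreal (std_normal_density z) * indicator A ((z + \<delta>) / c) \<partial>lborel)
          = (\<integral>\<^sup>+x. ennreal (chi_square_density n v) * (ennreal c *
              (ennreal (std_normal_density (x * c - \<delta>)) * indicator A x)) \<partial>lborel)"
        by (simp add: nn_integral_cmult)
      also have "\<dots> = (\<integral>\<^sup>+x. ennreal (c * std_normal_density (x * c - \<delta>) * chi_square_density n v) * indicator A x \<partial>lborel)"
        using c by (intro nn_integral_cong)
          (simp add: ennreal_mult chi_square_density_nonneg mult_ac)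
      finally show ?thesis by (simp add: c_def)
    qed (simp add: chi_square_density_def)
  qed
  also have "\<dots> = (\<integral>\<^sup>+x. \<integral>\<^sup>+v. ennreal (?f x v) * indicator A x \<partial>lborel \<partial>lborel)"
    by (rule lborel_pair.Fubini') measurable
  also have "\<dots> = (\<integral>\<^sup>+x. ennreal (noncentral_t_density n \<delta> x) * indicator A x \<partial>lborel)"
  proof (intro nn_integral_cong)
    fix x :: real
    have "(\<integral>\<^sup>+v. ennreal (?f x v) \<partial>lborel) = ennreal (noncentral_t_density n \<delta> x)"
      unfolding noncentral_t_density_def
      by (rule nn_integral_eq_integral[OF noncentral_t_integrable[OF assms]]) (simp add: nn)
    thus "(\<integral>\<^sup>+v. ennreal (?f x v) * indicator A x \<partial>lborel) = ennreal (noncentral_t_density n \<delta> x) * indicator A x"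
      by (simp add: nn_integral_multc)
  qed
  also have "\<dots> = emeasure (density lborel (noncentral_t_density n \<delta>)) A"
    by (subst emeasure_density) (auto simp: noncentral_t_density_def)
  finally show "emeasure (distr (?N \<Otimes>\<^sub>M ?C) borel ?T) A = emeasure (density lborel (noncentral_t_density n \<delta>)) A" .
qed simp

section \<open>Minimum attainable pFDR and minimum sample size\<close>

definition t_likelihood_ratio_sup :: "nat \<Rightarrow> real \<Rightarrow> real" where
  "t_likelihood_ratio_sup n r =
     (SUP x. noncentral_t_density n (sqrt (real n + 1) * r) x / student_t_density n x)"

text \<open>
  In the random effects model a null is false with probability \<open>\<pi>\<close>, a true null has
  \<open>T\<close> distributed with density \<open>student_t_density n\<close>, and a false null has \<open>T\<close> noncentral with
  parameter \<open>sqrt (n + 1) * (s * r)\<close>, where \<open>r\<close> is drawn from \<open>G\<close> (a probability measure on the reals).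
  The smallest pFDR that can be attained is then the following.
\<close>

definition min_pFDR :: "real \<Rightarrow> real measure \<Rightarrow> real \<Rightarrow> nat \<Rightarrow> real" where
  "min_pFDR \<pi> G s n =
     (1 - \<pi>) / (1 - \<pi> + \<pi> * (LINT r|G. t_likelihood_ratio_sup n (s * r)))"

definition min_sample_size :: "real \<Rightarrow> real \<Rightarrow> real measure \<Rightarrow> real \<Rightarrow> nat" where
  "min_sample_size \<alpha> \<pi> G s = (LEAST n. 1 \<le> n \<and> min_pFDR \<pi> G s n \<le> \<alpha>)"

definition Q_ratio :: "real \<Rightarrow> real \<Rightarrow> real" where
  "Q_ratio \<alpha> \<pi> = ((1 - \<alpha>) * (1 - \<pi>)) / (\<alpha> * \<pi>)"

definition moment_gen_fun :: "real measure \<Rightarrow> real \<Rightarrow> real" where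
  "moment_gen_fun G l = (LINT r|G. exp (l * r))"

end

(*
  With W chi-square distributed with n + 1 degrees of freedom, the likelihood ratio at x of the
  noncentral against the central t distribution is
  exp(-d^2/2) * E exp(d * x / sqrt(n + x^2) * sqrt W), so its supremum is exp(-d^2/2) * E exp(|d| * sqrt W).
  For d = sqrt(n + 1) * r with r >= 0 this gives

    exp(n r - (n + 1) r^2 / 2) <= L(n, r) <= exp((n + 1) r),

  from above by sqrt W <= (c + W / c) / 2 with an optimised c, from below by Jensen and
  E sqrt W >= sqrt n.  Let a be the solution of L_G(a) = Q.  Integrating the upper bound,
  n is sufficient only if (n + 1) s >= a; by the lower bound n = ceil(b / s) is sufficient for
  every b > a once s is small, because the loss from the quadratic term is O(s).
*)

theory Submission
  imports Defs "HOL-Real_Asymp.Real_Asymp"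
begin

section \<open>Exponential moments of the chi distribution\<close>

lemma has_bochner_integral_Gamma_kernel:
  fixes a b :: real
  assumes "0 < a" "0 < b"
  shows "has_bochner_integral lborel
           (\<lambda>v. indicator {0<..} v * (v powr (a - 1) * exp (- (b * v)))) (Gamma a / b powr a)"
proof (intro has_bochner_integral_nn_integral)
  show "0 \<le> Gamma a / b powr a"
    using assms by (intro divide_nonneg_nonneg less_imp_le[OF Gamma_real_pos]) auto
  show "(\<integral>\<^sup>+v. ennreal (indicator {0<..} v * (v powr (a - 1) * exp (- (b * v)))) \<partial>lborel)
      = ennreal (Gamma a / b powr a)"
    by (rule nn_integral_Gamma_kernel[OF assms])
  show "AE v in lborel. 0 \<le> indicator {0<..} v * (v powr (a - 1) * exp (- (b * v)))"
    by (intro AE_I2) simp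
  show "(\<lambda>v. indicator {0<..} v * (v powr (a - 1) * exp (- (b * v)))) \<in> borel_measurable lborel"
    by measurable
qed

text \<open>The factor \<open>exp (t * w)\<close> only changes the rate of the Gamma kernel from 1/2
  to 1/2 - t, which stays positive for t < 1/2. The case t = 0 gives the total mass.\<close>

lemma has_bochner_integral_exp_chi_square:
  assumes m: "1 \<le> m" and t: "t < 1 / 2"
  shows "has_bochner_integral lborel (\<lambda>w. exp (t * w) * chi_square_density m w)
           ((1 - 2 * t) powr (- (real m / 2)))"
proof -
  let ?c = "1 / (2 powr (real m / 2) * Gamma (real m / 2))"
  have G: "0 < Gamma (real m / 2)" using m by (intro Gamma_real_pos) simp
  have b: "0 < 1 / 2 - t" using t by simp
  have "has_bochner_integral lborel (\<lambda>v. ?c * (indicator {0<..} v *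
          (v powr (real m / 2 - 1) * exp (- ((1 / 2 - t) * v)))))
          (?c * (Gamma (real m / 2) / (1 / 2 - t) powr (real m / 2)))"
    using m b by (intro has_bochner_integral_mult_right has_bochner_integral_Gamma_kernel) auto
  also have "?c * (Gamma (real m / 2) / (1 / 2 - t) powr (real m / 2))
      = 1 / (2 powr (real m / 2) * (1 / 2 - t) powr (real m / 2))"
    using G by simp
  also have "2 powr (real m / 2) * (1 / 2 - t) powr (real m / 2) = (1 - 2 * t) powr (real m / 2)"
    using b powr_mult[of 2 "1 / 2 - t" "real m / 2"] by (simp add: right_diff_distrib)
  also have "(\<lambda>v. ?c * (indicator {0<..} v * (v powr (real m / 2 - 1) * exp (- ((1 / 2 - t) * v)))))
      = (\<lambda>w. exp (t * w) * chi_square_density m w)"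
  proof
    fix v :: real
    have "exp (- ((1 / 2 - t) * v)) = exp (t * v) * exp (- v / 2)"
      by (simp add: left_diff_distrib flip: exp_add)
    then show "?c * (indicator {0<..} v * (v powr (real m / 2 - 1) * exp (- ((1 / 2 - t) * v))))
      = exp (t * v) * chi_square_density m v"
      by (simp add: chi_square_density_def)
  qed
  finally show ?thesis by (simp only: powr_minus divide_inverse mult_1_left)
qed

lemma has_bochner_integral_chi_square:
  assumes "1 \<le> m"
  shows "has_bochner_integral lborel (chi_square_density m) 1"
  using has_bochner_integral_exp_chi_square[OF assms, of 0] by simp

lemma has_bochner_integral_sqrt_chi_square:
  assumes m: "1 \<le> m"
  shows "has_bochner_integral lborel (\<lambda>w. sqrt w * chi_square_density m w)
           (sqrt 2 * Gamma ((real m + 1) / 2) / Gamma (real m / 2))"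
proof -
  let ?c = "1 / (2 powr (real m / 2) * Gamma (real m / 2))"
  have "has_bochner_integral lborel (\<lambda>v. ?c * (indicator {0<..} v *
          (v powr ((real m + 1) / 2 - 1) * exp (- (1 / 2 * v)))))
          (?c * (Gamma ((real m + 1) / 2) / (1 / 2) powr ((real m + 1) / 2)))"
    using m by (intro has_bochner_integral_mult_right has_bochner_integral_Gamma_kernel) auto
  also have "?c * (Gamma ((real m + 1) / 2) / (1 / 2) powr ((real m + 1) / 2))
      = sqrt 2 * Gamma ((real m + 1) / 2) / Gamma (real m / 2)"
    by (simp add: powr_divide add_divide_distrib powr_add powr_half_sqrt)
  also have "(\<lambda>v. ?c * (indicator {0<..} v * (v powr ((real m + 1) / 2 - 1) * exp (- (1 / 2 * v)))))
      = (\<lambda>w. sqrt w * chi_square_density m w)"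
  proof
    fix v :: real
    show "?c * (indicator {0<..} v * (v powr ((real m + 1) / 2 - 1) * exp (- (1 / 2 * v))))
      = sqrt v * chi_square_density m v"
    proof (cases "0 < v")
      case True
      then have "sqrt v * v powr (real m / 2 - 1) = v powr ((real m + 1) / 2 - 1)"
        by (simp add: powr_half_sqrt [symmetric] powr_add [symmetric] add_divide_distrib)
      with True show ?thesis
        by (simp add: chi_square_density_def flip: mult.assoc)
    qed (simp add: chi_square_density_def)
  qed
  finally show ?thesis .
qed

text \<open>The mean is a quotient of Gamma values half a unit apart. With x = n/2, log-convexity of
  Gamma at the midpoint of x and x + 1, together with Gamma (x + 1) = x * Gamma x, bounds it from
  below.\<close>

lemma integral_sqrt_chi_square_ge:
  "sqrt (real n) \<le> (LINT w|lborel. sqrt w * chi_square_density (Suc n) w)"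
proof (cases "n = 0")
  case True
  have "0 \<le> sqrt w * chi_square_density (Suc n) w" for w
    by (cases "0 < w") (auto simp: chi_square_density_nonneg chi_square_density_def[of _ w])
  with True show ?thesis by (simp add: integral_nonneg)
next
  case False
  define x where "x = real n / 2"
  have x: "0 < x" using False by (simp add: x_def)
  have G: "0 < Gamma x" "0 < Gamma (x + 1 / 2)" "0 < Gamma (x + 1)"
    using x by (auto intro!: Gamma_real_pos)
  have "convex_on {0<..} (ln \<circ> Gamma :: real \<Rightarrow> real)"
    by (rule log_convex_Gamma_real)
  from convex_onD[OF this, of "1/2" x "x + 1"] x
  have "ln (Gamma (x + 1 / 2)) \<le> (ln (Gamma x) + ln (Gamma (x + 1))) / 2"
    by (simp add: field_simps)
  then have "ln ((Gamma (x + 1 / 2))\<^sup>2) \<le> ln (Gamma x * Gamma (x + 1))"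
    using G by (simp add: ln_mult ln_realpow)
  then have "(Gamma (x + 1 / 2))\<^sup>2 \<le> Gamma x * Gamma (x + 1)"
    using G by simp
  also have "Gamma x = Gamma (x + 1) / x"
    using x Gamma_plus1[of x] by (auto simp: nonpos_Ints_def)
  finally have "x \<le> (Gamma (x + 1) / Gamma (x + 1 / 2))\<^sup>2"
    using x G by (simp add: field_simps power2_eq_square)
  then have "sqrt x \<le> Gamma (x + 1) / Gamma (x + 1 / 2)"
    using G by (simp add: real_le_lsqrt)
  from mult_left_mono[OF this, of "sqrt 2"]
  have "sqrt 2 * sqrt x \<le> sqrt 2 * Gamma (x + 1) / Gamma (x + 1 / 2)"
    by simp
  also have "sqrt 2 * sqrt x = sqrt (real n)"
    by (simp add: x_def real_sqrt_mult [symmetric])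
  also have "x + 1 = (real (Suc n) + 1) / 2"
    by (simp add: x_def field_simps)
  also have "x + 1 / 2 = real (Suc n) / 2"
    by (simp add: x_def field_simps)
  finally show ?thesis
    using has_bochner_integral_integral_eq[OF has_bochner_integral_sqrt_chi_square[of "Suc n"]] by simp
qed

section \<open>Moment generating function of the chi distribution and its bounds\<close>

definition chi_mgf :: "nat \<Rightarrow> real \<Rightarrow> real" where
  "chi_mgf m d = (LINT w|lborel. exp (d * sqrt w) * chi_square_density m w)"

lemma chi_mgf_measurable [measurable]: "chi_mgf m \<in> borel_measurable borel"
  unfolding chi_mgf_def by measurable

text \<open>The inequality between arithmetic and geometric means makes the exponent linear in w, so
  that the explicit chi-square exponential moments apply. The parameter c is left free for
  tuning.\<close>

lemma exp_sqrt_le: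
  fixes d c w :: real
  assumes "0 \<le> d" "0 < c" "0 \<le> w"
  shows "exp (d * sqrt w) \<le> exp (d * c / 2) * exp (d / (2 * c) * w)"
proof -
  have "0 \<le> (sqrt w - c)\<^sup>2" by simp
  then have "2 * c * sqrt w \<le> c\<^sup>2 + w"
    using assms by (simp add: power2_diff mult_ac add_ac)
  then have "sqrt w \<le> c / 2 + w / (2 * c)"
    using assms by (simp add: field_simps power2_eq_square)
  from mult_left_mono[OF this assms(1)] have "d * sqrt w \<le> d * c / 2 + d / (2 * c) * w"
    by (simp add: algebra_simps)
  then show ?thesis by (simp add: exp_add [symmetric])
qed

lemma chi_mgf_integrable:
  assumes m: "1 \<le> m"
  shows "integrable lborel (\<lambda>w. exp (d * sqrt w) * chi_square_density m w)"
proof (rule Bochner_Integration.integrable_bound)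
  \<comment> \<open>Any c > \<bar>d\<bar> makes the linear rate \<bar>d\<bar> / (2 * c) smaller than
    1/2, the range where exponential moments are finite.\<close>
  define c where "c = 2 * (\<bar>d\<bar> + 1)"
  have c: "0 < c" "\<bar>d\<bar> / (2 * c) < 1 / 2" by (auto simp: c_def field_simps)
  let ?g = "\<lambda>w. exp (\<bar>d\<bar> * c / 2) * (exp (\<bar>d\<bar> / (2 * c) * w) * chi_square_density m w)"
  show "integrable lborel ?g"
    using has_bochner_integral_exp_chi_square[OF m c(2)]
    by (intro integrable_mult_right) (rule integrable.intros)
  show "AE w in lborel. norm (exp (d * sqrt w) * chi_square_density m w) \<le> norm (?g w)"
  proof (intro AE_I2)
    fix w :: real
    show "norm (exp (d * sqrt w) * chi_square_density m w) \<le> norm (?g w)"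
    proof (cases "0 < w")
      case True
      then have "exp (d * sqrt w) \<le> exp (\<bar>d\<bar> * sqrt w)" by (simp add: mult_right_mono)
      also have "\<dots> \<le> exp (\<bar>d\<bar> * c / 2) * exp (\<bar>d\<bar> / (2 * c) * w)"
        using True c by (intro exp_sqrt_le) auto
      finally show ?thesis
        using chi_square_density_nonneg[of m w]
        by (simp add: abs_mult mult_right_mono flip: mult.assoc)
    qed (simp add: chi_square_density_def)
  qed
qed measurable

lemma chi_mgf_le:
  assumes m: "1 \<le> m" and d: "0 \<le> d"
  shows "chi_mgf m d \<le> exp (d\<^sup>2 / 2 + d * sqrt (real m))"
proof -
  \<comment> \<open>This choice makes the bound sharp enough for its \<open>exp (d\<^sup>2 / 2)\<close> to cancel exactly against the
    factor \<open>exp (- \<delta>\<^sup>2 / 2)\<close> of the likelihood ratio.\<close>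
  define c where "c = d + sqrt (real m)"
  have sm: "0 < sqrt (real m)" using m by simp
  have "d < c" "0 < c" using sm d by (auto simp: c_def simp del: real_sqrt_gt_0_iff)
  then have c: "0 < c" "d / (2 * c) < 1 / 2" by (auto simp: field_simps)
  note H = has_bochner_integral_mult_right[OF has_bochner_integral_exp_chi_square[OF m c(2)],
      of "exp (d * c / 2)"]
  have "chi_mgf m d \<le> (LINT w|lborel. exp (d * c / 2) * (exp (d / (2 * c) * w) * chi_square_density m w))"
    unfolding chi_mgf_def
  proof (intro integral_mono chi_mgf_integrable m)
    show "integrable lborel (\<lambda>w. exp (d * c / 2) * (exp (d / (2 * c) * w) * chi_square_density m w))"
      by (rule integrable.intros) (rule H)
    fix w :: real
    show "exp (d * sqrt w) * chi_square_density m w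
        \<le> exp (d * c / 2) * (exp (d / (2 * c) * w) * chi_square_density m w)"
    proof (cases "0 < w")
      case True
      with exp_sqrt_le[of d c w] c d chi_square_density_nonneg[of m w] show ?thesis
        by (simp add: mult_right_mono flip: mult.assoc)
    qed (simp add: chi_square_density_def)
  qed
  also have "\<dots> = exp (d * c / 2) * (1 - 2 * (d / (2 * c))) powr (- (real m / 2))"
    by (rule has_bochner_integral_integral_eq) (rule H)
  \<comment> \<open>By the choice of c, 1 - d / c = sqrt m / (d + sqrt m).\<close>
  also have "1 - 2 * (d / (2 * c)) = inverse (1 + d / sqrt (real m))"
    using sm d by (simp add: c_def field_simps add_nonneg_eq_0_iff)
  also have "\<dots> powr (- (real m / 2)) = (1 + d / sqrt (real m)) powr (real m / 2)"
    using sm d by (simp add: powr_minus inverse_powr add_pos_nonneg)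
  \<comment> \<open>Here 1 + u \<le> exp u with u = d / sqrt m. The resulting d * sqrt m / 2 adds to
    d * c / 2 to give the claimed exponent.\<close>
  also have "\<dots> \<le> exp (d / sqrt (real m)) powr (real m / 2)"
    using sm d by (intro powr_mono2) (auto simp: add_pos_nonneg)
  also have "\<dots> = exp (d * sqrt (real m) / 2)"
    using m by (simp add: exp_powr_real real_div_sqrt field_simps)
  also have "exp (d * c / 2) * exp (d * sqrt (real m) / 2) = exp (d\<^sup>2 / 2 + d * sqrt (real m))"
    by (simp add: c_def exp_add [symmetric] power2_eq_square field_simps)
  finally show ?thesis by simp
qed

text \<open>Jensen's inequality by hand: exp is bounded below by its tangent at d * sqrt n. The
  tangent point is not the mean, so the mean enters only through its lower bound, with the
  nonnegative coefficient \<open>?e * d\<close>.\<close>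

lemma chi_mgf_ge:
  assumes d: "0 \<le> d"
  shows "exp (d * sqrt (real n)) \<le> chi_mgf (Suc n) d"
proof -
  let ?C = "chi_square_density (Suc n)" and ?e = "exp (d * sqrt (real n))"
  note H1 = has_bochner_integral_chi_square[of "Suc n"]
  note H2 = has_bochner_integral_sqrt_chi_square[of "Suc n"]
  have i: "integrable lborel ?C" "integrable lborel (\<lambda>w. sqrt w * ?C w)"
    using H1 H2 by (auto intro: integrable.intros)
  have "?e \<le> ?e * (1 - d * sqrt (real n)) * 1 + ?e * d * (LINT w|lborel. sqrt w * ?C w)"
    using mult_left_mono[OF integral_sqrt_chi_square_ge[of n], of "?e * d"] d
    by (simp add: algebra_simps)
  also have "\<dots> = (LINT w|lborel. ?e * (1 - d * sqrt (real n)) * ?C w + ?e * d * (sqrt w * ?C w))"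
    using i has_bochner_integral_integral_eq[OF H1] by simp
  also have "\<dots> \<le> chi_mgf (Suc n) d"
    unfolding chi_mgf_def
  proof (intro integral_mono chi_mgf_integrable)
    show "integrable lborel (\<lambda>w. ?e * (1 - d * sqrt (real n)) * ?C w + ?e * d * (sqrt w * ?C w))"
      using i by simp
    fix w :: real
    have "?e * (1 + (d * sqrt w - d * sqrt (real n))) \<le> ?e * exp (d * sqrt w - d * sqrt (real n))"
      by (intro mult_left_mono exp_ge_add_one_self) simp
    also have "\<dots> = exp (d * sqrt w)"
      by (simp add: exp_add [symmetric])
    finally show "?e * (1 - d * sqrt (real n)) * ?C w + ?e * d * (sqrt w * ?C w)
        \<le> exp (d * sqrt w) * ?C w"
      using mult_right_mono[OF _ chi_square_density_nonneg[of "Suc n" w]]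
      by (fastforce simp: algebra_simps)
  qed simp
  finally show ?thesis .
qed

section \<open>The likelihood ratio of the noncentral \<open>t\<close> distribution\<close>

lemma student_t_density_pos: "1 \<le> n \<Longrightarrow> 0 < student_t_density n x"
proof -
  assume "1 \<le> n"
  then have "0 < 1 + x\<^sup>2 / real n" by (intro add_pos_nonneg) auto
  then show ?thesis using \<open>1 \<le> n\<close> by (simp add: student_t_density_def Gamma_real_pos)
qed

text \<open>Expanding the normal square leaves a term linear in v, which joins the chi-square
  weight, and a cross term in sqrt v, which becomes the exponent of \<open>chi_mgf\<close>. The
  extra factor sqrt v raises the degrees of freedom from n to n + 1. The likelihood ratio thus
  depends on x only through x / sqrt (n + \<open>x\<^sup>2\<close>).\<close>

lemma noncentral_t_density_eq:
  assumes n: "1 \<le> n"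
  shows "noncentral_t_density n \<delta> x
           = student_t_density n x * exp (- \<delta>\<^sup>2 / 2) * chi_mgf (Suc n) (\<delta> * (x / sqrt (real n + x\<^sup>2)))"
proof -
  let ?m = "real n"
  define q where "q = 1 + x\<^sup>2 / ?m"
  define y where "y = x / sqrt (?m + x\<^sup>2)"
  have m: "0 < ?m" using n by simp
  have q: "0 < q" unfolding q_def using m by (intro add_pos_nonneg) auto
  have qm: "?m + x\<^sup>2 = q * ?m" using m by (simp add: q_def field_simps)
  have G: "0 < Gamma (?m / 2)" "0 < Gamma ((?m + 1) / 2)" using m by (auto intro!: Gamma_real_pos)
  let ?F = "\<lambda>v. sqrt (v / ?m) * std_normal_density (x * sqrt (v / ?m) - \<delta>) * chi_square_density n v"
  have "noncentral_t_density n \<delta> x = (1 / q) * (LINT w|lborel. ?F (0 + (1 / q) * w))"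
    \<comment> \<open>this rescaling turns the weight \<open>exp (- v / 2) * exp (- x\<^sup>2 * v / (2 * n))\<close> into \<open>exp (- w / 2)\<close>\<close>
    unfolding noncentral_t_density_def using q
    by (subst lborel_integral_real_affine[where c = "1 / q" and t = 0]) auto
  also have "\<dots> = (LINT w|lborel. (1 / q) * ?F (0 + (1 / q) * w))"
    by simp
  also have "\<dots> = (LINT w|lborel. (student_t_density n x * exp (- \<delta>\<^sup>2 / 2))
      * (exp (\<delta> * y * sqrt w) * chi_square_density (Suc n) w))"
  proof (intro Bochner_Integration.integral_cong refl)
    fix w :: real
    show "(1 / q) * ?F (0 + (1 / q) * w) = (student_t_density n x * exp (- \<delta>\<^sup>2 / 2))
      * (exp (\<delta> * y * sqrt w) * chi_square_density (Suc n) w)"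
    proof (cases "0 < w")
      case True
      have sq: "x * sqrt (1 / q * w / ?m) = y * sqrt w"
        using True q m by (simp add: y_def qm real_sqrt_divide)
      have y2: "y\<^sup>2 = x\<^sup>2 / (q * ?m)"
        using q m by (simp add: y_def qm power_divide)
      \<comment> \<open>The numbers \<open>y\<^sup>2\<close> and 1 / q sum to 1, so the two
        quadratic contributions merge into the weight exp (- w / 2).\<close>
      have yq: "y\<^sup>2 * w + w / q = w"
      proof -
        have "y\<^sup>2 * w + w / q = w * (q * ?m) / (q * ?m)"
          unfolding y2 using q m qm by (simp add: divide_simps) (simp add: algebra_simps flip: distrib_left)
        then show ?thesis using q m by simp
      qed
      have e: "exp (- (y * sqrt w - \<delta>)\<^sup>2 / 2) * exp (- (w / q) / 2)
          = exp (- \<delta>\<^sup>2 / 2) * (exp (\<delta> * y * sqrt w) * exp (- w / 2))"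
        unfolding exp_add [symmetric] 
      proof (rule arg_cong[where f = exp])
        have "- (y * sqrt w - \<delta>)\<^sup>2 / 2 + - (w / q) / 2
            = - \<delta>\<^sup>2 / 2 + (\<delta> * y * sqrt w + - (y\<^sup>2 * w + w / q) / 2)"
          using True by (simp add: power2_diff power_mult_distrib algebra_simps diff_divide_distrib add_divide_distrib)
        then show "- (y * sqrt w - \<delta>)\<^sup>2 / 2 + - (w / q) / 2 = - \<delta>\<^sup>2 / 2 + (\<delta> * y * sqrt w + - w / 2)"
          unfolding yq .
      qed
      have p: "sqrt w * w powr (?m / 2 - 1) = w powr ((?m + 1) / 2 - 1)"
        using True by (simp add: powr_half_sqrt [symmetric] powr_add [symmetric] add_divide_distrib)
      \<comment> \<open>The powers of q come from the substitution, the factor sqrt v and the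
        chi-square density; the exponents -1, -1/2 and 1 - n/2 sum to -(n + 1)/2, that of the t
        kernel.\<close>
      have c: "(1 / q) * (1 / sqrt (q * ?m)) * (1 / sqrt (2 * pi)) *
            (1 / q powr (?m / 2 - 1)) / (2 powr (?m / 2) * Gamma (?m / 2))
          = student_t_density n x / (2 powr ((?m + 1) / 2) * Gamma ((?m + 1) / 2))"
      proof -
        have "q powr (- (?m + 1) / 2) = 1 / (q powr (?m / 2) * sqrt q)"
          using q by (simp add: minus_divide_left [symmetric] powr_minus add_divide_distrib powr_add
              powr_half_sqrt inverse_eq_divide del: minus_add_distrib)
        moreover have "q powr (?m / 2 - 1) = q powr (?m / 2) / q"
          using q by (simp add: powr_diff)
        moreover have "2 powr ((?m + 1) / 2) = 2 powr (?m / 2) * sqrt 2"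
          by (simp add: add_divide_distrib powr_add powr_half_sqrt)
        moreover have "Gamma (?m / 2) \<noteq> 0" using G(1) by linarith
        moreover have "Gamma ((?m + 1) / 2) \<noteq> 0" using G(2) by linarith
        ultimately show ?thesis
          unfolding student_t_density_def q_def [symmetric] using q m
          by (simp add: real_sqrt_mult)
      qed
      have "(1 / q) * ?F (0 + (1 / q) * w)
          = ((1 / q) * (1 / sqrt (q * ?m)) * (1 / sqrt (2 * pi)) *
              (1 / q powr (?m / 2 - 1)) / (2 powr (?m / 2) * Gamma (?m / 2)))
            * (sqrt w * w powr (?m / 2 - 1))
            * (exp (- (y * sqrt w - \<delta>)\<^sup>2 / 2) * exp (- (w / q) / 2))"
      proof -
        have v: "0 + (1 / q) * w = w / q" "1 / q * w / ?m = w / q / ?m" by simp_all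
        have "(w / q) powr (?m / 2 - 1) = w powr (?m / 2 - 1) * (1 / q powr (?m / 2 - 1))"
          using True q by (simp add: powr_divide)
        moreover have "sqrt (w / q / ?m) = sqrt w * (1 / sqrt (q * ?m))"
          by (simp add: real_sqrt_divide real_sqrt_mult)
        moreover have "0 < w / q" using True q by simp
        ultimately show ?thesis
          unfolding v std_normal_density_def chi_square_density_def sq[unfolded v]
          by (simp only: if_True divide_inverse mult_1_left mult_1_right mult_ac)
      qed
      then show ?thesis
        unfolding c p e using True by (simp add: chi_square_density_def add.commute)
    qed (use q in \<open>simp add: chi_square_density_def field_simps\<close>)
  qed
  also have "\<dots> = student_t_density n x * exp (- \<delta>\<^sup>2 / 2) * chi_mgf (Suc n) (\<delta> * y)"
    by (simp add: chi_mgf_def)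
  finally show ?thesis unfolding y_def .
qed

text \<open>The supremum is approached as \<open>x\<close> tends to infinity with the sign of \<open>\<delta>\<close>, where
  \<open>x / sqrt (n + x\<^sup>2)\<close> tends to that sign.\<close>

lemma SUP_likelihood_ratio:
  assumes n: "1 \<le> n"
  shows "(SUP x. noncentral_t_density n \<delta> x / student_t_density n x)
           = exp (- \<delta>\<^sup>2 / 2) * chi_mgf (Suc n) \<bar>\<delta>\<bar>" (is "(SUP x. ?R x) = ?L")
proof -
  define y where "y x = x / sqrt (real n + x\<^sup>2)" for x :: real
  have R: "?R x = exp (- \<delta>\<^sup>2 / 2) * chi_mgf (Suc n) (\<delta> * y x)" for x
    using student_t_density_pos[OF n, of x] by (simp add: noncentral_t_density_eq[OF n] y_def)
  have y: "\<bar>y x\<bar> \<le> 1" for x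
  proof -
    have "0 < sqrt (real n + x\<^sup>2)" using n by (simp add: add_pos_nonneg)
    moreover have "\<bar>x\<bar> \<le> sqrt (real n + x\<^sup>2)" by (intro real_le_rsqrt) auto
    ultimately show ?thesis by (simp add: y_def)
  qed
  have bound: "exp (\<delta> * y x * sqrt w) * chi_square_density (Suc n) w
      \<le> exp (\<bar>\<delta>\<bar> * sqrt w) * chi_square_density (Suc n) w" for x w
  proof (cases "0 < w")
    case True
    have "\<delta> * y x \<le> \<bar>\<delta>\<bar> * \<bar>y x\<bar>" by (metis abs_ge_self abs_mult)
    also have "\<dots> \<le> \<bar>\<delta>\<bar>" using y[of x] by (simp add: mult_left_le)
    finally show ?thesis
      using True by (intro mult_right_mono chi_square_density_nonneg) (simp add: mult_right_mono)
  qed (simp add: chi_square_density_def)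
  have le: "?R x \<le> ?L" for x
    unfolding R chi_mgf_def
    by (intro mult_left_mono integral_mono chi_mgf_integrable bound) auto
  \<comment> \<open>For \<delta> = 0 the sequence stays at x = 0, which is harmless because the
    ratio is then constant in x.\<close>
  have "(\<lambda>k. chi_mgf (Suc n) (\<delta> * y (sgn \<delta> * real k))) \<longlonglongrightarrow> chi_mgf (Suc n) \<bar>\<delta>\<bar>"
    unfolding chi_mgf_def
  proof (rule integral_dominated_convergence)
    have "(\<lambda>k. real k / sqrt (real n + (real k)\<^sup>2)) \<longlonglongrightarrow> 1"
      by real_asymp
    then have "(\<lambda>k. \<bar>\<delta>\<bar> * (real k / sqrt (real n + (real k)\<^sup>2))) \<longlonglongrightarrow> \<bar>\<delta>\<bar> * 1"
      by (intro tendsto_mult tendsto_const)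
    also have "(\<lambda>k. \<bar>\<delta>\<bar> * (real k / sqrt (real n + (real k)\<^sup>2))) = (\<lambda>k. \<delta> * y (sgn \<delta> * real k))"
      by (auto simp: y_def sgn_if)
    finally have "(\<lambda>k. \<delta> * y (sgn \<delta> * real k)) \<longlonglongrightarrow> \<bar>\<delta>\<bar>" by simp
    then show "AE w in lborel. (\<lambda>k. exp (\<delta> * y (sgn \<delta> * real k) * sqrt w) * chi_square_density (Suc n) w)
        \<longlonglongrightarrow> exp (\<bar>\<delta>\<bar> * sqrt w) * chi_square_density (Suc n) w"
      by (intro AE_I2 tendsto_intros)
    show "integrable lborel (\<lambda>w. exp (\<bar>\<delta>\<bar> * sqrt w) * chi_square_density (Suc n) w)"
      by (rule chi_mgf_integrable) simp
    show "AE w in lborel. norm (exp (\<delta> * y (sgn \<delta> * real k) * sqrt w) * chi_square_density (Suc n) w)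
        \<le> exp (\<bar>\<delta>\<bar> * sqrt w) * chi_square_density (Suc n) w" for k
      using bound by (intro AE_I2) (simp add: abs_mult chi_square_density_nonneg)
  qed measurable
  then have "(\<lambda>k. ?R (sgn \<delta> * real k)) \<longlonglongrightarrow> ?L"
    unfolding R by (intro tendsto_mult tendsto_const)
  moreover have "bdd_above (range ?R)" using le by (intro bdd_aboveI2)
  then have "?R x \<le> (SUP x. ?R x)" for x by (rule cSUP_upper[rotated]) simp
  ultimately have "?L \<le> (SUP x. ?R x)"
    by (intro LIMSEQ_le_const2) auto
  moreover have "(SUP x. ?R x) \<le> ?L"
    using le by (intro cSUP_least) auto
  ultimately show ?thesis by (rule antisym[rotated])
qed

section \<open>Closed form and two-sided bounds for L(n, r)\<close>

lemma t_likelihood_ratio_sup_eq: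
  assumes "1 \<le> n"
  shows "t_likelihood_ratio_sup n r
           = exp (- ((real n + 1) * r\<^sup>2 / 2)) * chi_mgf (Suc n) \<bar>sqrt (real n + 1) * r\<bar>"
  unfolding t_likelihood_ratio_sup_def SUP_likelihood_ratio[OF assms]
  by (simp add: power_mult_distrib)

lemma t_likelihood_ratio_sup_le:
  assumes "1 \<le> n" "0 \<le> r"
  shows "t_likelihood_ratio_sup n r \<le> exp ((real n + 1) * r)"
proof -
  let ?d = "sqrt (real n + 1) * r"
  have "t_likelihood_ratio_sup n r \<le> exp (- ((real n + 1) * r\<^sup>2 / 2)) * exp (?d\<^sup>2 / 2 + ?d * sqrt (real n + 1))"
    unfolding t_likelihood_ratio_sup_eq[OF assms(1)]
    using assms chi_mgf_le[of "Suc n" ?d] by (intro mult_left_mono) (auto simp: abs_mult add.commute)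
  also have "\<dots> = exp ((real n + 1) * r)"
    by (simp add: exp_add [symmetric] power_mult_distrib)
  finally show ?thesis .
qed

text \<open>The Jensen bound has no term \<open>d\<^sup>2 / 2\<close> to offset the Gaussian factor,
  so the quadratic loss remains; sqrt (n + 1) is lowered to sqrt n to get n * r.\<close>

lemma t_likelihood_ratio_sup_ge:
  assumes "1 \<le> n" "0 \<le> r"
  shows "exp (real n * r - (real n + 1) * r\<^sup>2 / 2) \<le> t_likelihood_ratio_sup n r"
proof -
  let ?d = "sqrt (real n + 1) * r"
  have "real n = sqrt (real n) * sqrt (real n)" by simp
  also have "\<dots> \<le> sqrt (real n + 1) * sqrt (real n)" by (intro mult_right_mono) auto
  finally have "real n * r \<le> ?d * sqrt (real n)"
    using assms(2) mult_right_mono by (fastforce simp: mult_ac)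
  then have "exp (real n * r) \<le> exp (?d * sqrt (real n))" by simp
  also have "\<dots> \<le> chi_mgf (Suc n) \<bar>?d\<bar>"
    using assms chi_mgf_ge[of ?d n] by simp
  finally have "exp (- ((real n + 1) * r\<^sup>2 / 2)) * exp (real n * r) \<le> t_likelihood_ratio_sup n r"
    unfolding t_likelihood_ratio_sup_eq[OF assms(1)] by (intro mult_left_mono) auto
  then show ?thesis by (simp add: exp_add [symmetric])
qed

text \<open>The supremum ranges over an uncountable set, so measurability is read off from the
  closed form.\<close>

lemma t_likelihood_ratio_sup_measurable [measurable]:
  "1 \<le> n \<Longrightarrow> t_likelihood_ratio_sup n \<in> borel_measurable borel"
  by (subst measurable_cong[OF t_likelihood_ratio_sup_eq]) measurable

section \<open>The moment generating function of the effect size distribution\<close>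

locale subgaussian_effect_size = real_distribution M for M :: "real measure" +
  assumes AE_pos: "AE r in M. 0 < r"
    and subgaussian: "\<exists>l>0. integrable M (\<lambda>r. exp (l * r\<^sup>2))"
begin

text \<open>Completing the square bounds c * r by \<open>l * r\<^sup>2\<close> plus a
  constant.\<close>

lemma integrable_exp_mult: "integrable M (\<lambda>r. exp (c * r))"
proof -
  obtain l where l: "l > 0" "integrable M (\<lambda>r. exp (l * r\<^sup>2))"
    using subgaussian by blast
  show ?thesis
  proof (rule Bochner_Integration.integrable_bound)
    show "integrable M (\<lambda>r. exp (c\<^sup>2 / (4 * l)) * exp (l * r\<^sup>2))"
      using l(2) by simp
    show "AE r in M. norm (exp (c * r)) \<le> norm (exp (c\<^sup>2 / (4 * l)) * exp (l * r\<^sup>2))"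
    proof (intro AE_I2)
      fix r :: real
      have "0 \<le> (2 * l * r - c)\<^sup>2 / (4 * l)" using l by simp
      also have "\<dots> = c\<^sup>2 / (4 * l) + l * r\<^sup>2 - c * r"
        using l by (simp add: power2_eq_square field_simps)
      finally show "norm (exp (c * r)) \<le> norm (exp (c\<^sup>2 / (4 * l)) * exp (l * r\<^sup>2))"
        by (simp flip: exp_add)
    qed
  qed measurable
qed

text \<open>This makes the error term of the integrated lower bound finite; for r > 0 the square is
  absorbed by 2 * exp r.\<close>

lemma integrable_square_exp_mult: "integrable M (\<lambda>r. r\<^sup>2 * exp (c * r))"
proof (rule Bochner_Integration.integrable_bound)
  show "integrable M (\<lambda>r. 2 * exp ((c + 1) * r))"
    by (intro integrable_mult_right integrable_exp_mult)
  show "AE r in M. norm (r\<^sup>2 * exp (c * r)) \<le> norm (2 * exp ((c + 1) * r))"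
    using AE_pos
  proof eventually_elim
    case (elim r)
    then have "r\<^sup>2 \<le> 2 * exp r" using exp_lower_Taylor_quadratic[of r] by simp
    moreover have "exp ((c + 1) * r) = exp r * exp (c * r)"
      by (simp add: distrib_right flip: exp_add)
    ultimately show ?case
      using mult_right_mono[of "r\<^sup>2" "2 * exp r" "exp (c * r)"] by simp
  qed
qed measurable

lemma integrable_id: "integrable M (\<lambda>r. r)"
proof (rule Bochner_Integration.integrable_bound)
  show "integrable M (\<lambda>r. exp (1 * r))" by (rule integrable_exp_mult)
  show "AE r in M. norm r \<le> norm (exp (1 * r))"
    using AE_pos
  proof eventually_elim
    case (elim r)
    have "1 + r \<le> exp r" by (rule exp_ge_add_one_self)
    then have "r \<le> exp r" by linarith
    with elim show ?case by simp
  qed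
qed measurable

lemma expectation_id_pos: "0 < expectation (\<lambda>r. r)"
  using integral_less_AE_space[of "\<lambda>_. 0" "\<lambda>r. r"] integrable_id AE_pos emeasure_space_1 by simp

text \<open>Integrating exp u \<ge> 1 + u gives a growth rate of at least the mean, which is
  positive. This yields both strict monotonicity and unboundedness.\<close>

lemma moment_gen_fun_increment:
  assumes "0 \<le> x" "x \<le> y"
  shows "(y - x) * expectation (\<lambda>r. r) \<le> moment_gen_fun M y - moment_gen_fun M x"
proof -
  have "(y - x) * expectation (\<lambda>r. r) = (LINT r|M. (y - x) * r)" by simp
  also have "\<dots> \<le> (LINT r|M. exp (y * r) - exp (x * r))"
  proof (rule integral_mono_AE)
    show "AE r in M. (y - x) * r \<le> exp (y * r) - exp (x * r)"
      using AE_pos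
    proof eventually_elim
      case (elim r)
      have "1 + (y - x) * r \<le> exp ((y - x) * r)" by (rule exp_ge_add_one_self)
      then have "(y - x) * r \<le> exp ((y - x) * r) - 1" by linarith
      then have "1 * ((y - x) * r) \<le> exp (x * r) * (exp ((y - x) * r) - 1)"
        using assms elim by (intro mult_mono) auto
      also have "\<dots> = exp (y * r) - exp (x * r)"
        by (simp add: algebra_simps flip: exp_add)
      finally show ?case by simp
    qed
  qed (use integrable_id integrable_exp_mult in auto)
  also have "\<dots> = moment_gen_fun M y - moment_gen_fun M x"
    unfolding moment_gen_fun_def by (intro Bochner_Integration.integral_diff integrable_exp_mult)
  finally show ?thesis .
qed

lemma moment_gen_fun_0: "moment_gen_fun M 0 = 1"
  using prob_space by (simp add: moment_gen_fun_def)

lemma strict_mono_on_moment_gen_fun: "strict_mono_on {0..} (moment_gen_fun M)"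
proof (rule strict_mono_onI)
  fix x y :: real assume "x \<in> {0..}" "y \<in> {0..}" "x < y"
  then show "moment_gen_fun M x < moment_gen_fun M y"
    using moment_gen_fun_increment[of x y] mult_pos_pos[OF _ expectation_id_pos, of "y - x"] by simp
qed

text \<open>Convexity is inherited from exp, and a finite convex function on an open set of reals is
  continuous.\<close>

lemma continuous_on_moment_gen_fun: "continuous_on UNIV (moment_gen_fun M)"
proof (rule convex_on_continuous)
  show "convex_on UNIV (moment_gen_fun M)"
  proof (rule convex_onI)
    fix t x y :: real assume t: "0 < t" "t < 1"
    have "moment_gen_fun M ((1 - t) *\<^sub>R x + t *\<^sub>R y)
        \<le> (LINT r|M. (1 - t) * exp (x * r) + t * exp (y * r))"
      unfolding moment_gen_fun_def
    proof (rule integral_mono)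
      show "exp (((1 - t) *\<^sub>R x + t *\<^sub>R y) * r) \<le> (1 - t) * exp (x * r) + t * exp (y * r)" for r
        using convex_onD[OF exp_convex, of t "x * r" "y * r"] t by (simp add: algebra_simps)
    qed (auto intro!: integrable_exp_mult Bochner_Integration.integrable_add integrable_mult_right)
    also have "\<dots> = (1 - t) * moment_gen_fun M x + t * moment_gen_fun M y"
      unfolding moment_gen_fun_def by (simp add: integrable_exp_mult)
    finally show "moment_gen_fun M ((1 - t) *\<^sub>R x + t *\<^sub>R y)
        \<le> (1 - t) * moment_gen_fun M x + t * moment_gen_fun M y" .
  qed auto
qed auto

lemma ex_moment_gen_fun_eq:
  assumes "1 \<le> q"
  shows "\<exists>x\<ge>0. moment_gen_fun M x = q"
proof -
  \<comment> \<open>By the increment bound from 0, the value at this y is at least 1 + q.\<close>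
  define y where "y = q / expectation (\<lambda>r. r)"
  have y: "0 \<le> y" using assms expectation_id_pos by (simp add: y_def)
  have "q \<le> moment_gen_fun M y"
    using moment_gen_fun_increment[of 0 y] y expectation_id_pos by (simp add: moment_gen_fun_0 y_def)
  then show ?thesis
    using IVT'[of "moment_gen_fun M" 0 q y] y assms moment_gen_fun_0
      continuous_on_subset[OF continuous_on_moment_gen_fun, of "{0..y}"] by auto
qed

section \<open>The minimum sample size\<close>

lemma integrable_t_likelihood_ratio_sup:
  assumes "1 \<le> n" "0 \<le> s"
  shows "integrable M (\<lambda>r. t_likelihood_ratio_sup n (s * r))"
proof (rule Bochner_Integration.integrable_bound)
  show "integrable M (\<lambda>r. exp (((real n + 1) * s) * r))" by (rule integrable_exp_mult)
  show "AE r in M. norm (t_likelihood_ratio_sup n (s * r)) \<le> norm (exp (((real n + 1) * s) * r))"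
    using AE_pos
  proof eventually_elim
    case (elim r)
    then have "0 \<le> s * r" using assms by simp
    then show ?case
      using t_likelihood_ratio_sup_le[OF assms(1), of "s * r"]
        order_trans[OF less_imp_le[OF exp_gt_zero] t_likelihood_ratio_sup_ge[OF assms(1), of "s * r"]]
      by (simp add: mult_ac)
  qed
  show "(\<lambda>r. t_likelihood_ratio_sup n (s * r)) \<in> borel_measurable M"
    by (rule measurable_compose[OF _ t_likelihood_ratio_sup_measurable[OF assms(1)]]) measurable
qed

lemma integral_t_likelihood_ratio_sup_le:
  assumes "1 \<le> n" "0 \<le> s"
  shows "(LINT r|M. t_likelihood_ratio_sup n (s * r)) \<le> moment_gen_fun M ((real n + 1) * s)"
  unfolding moment_gen_fun_def
proof (intro integral_mono_AE integrable_t_likelihood_ratio_sup integrable_exp_mult assms)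
  show "AE r in M. t_likelihood_ratio_sup n (s * r) \<le> exp ((real n + 1) * s * r)"
    using AE_pos
  proof eventually_elim
    case (elim r)
    then show ?case
      using t_likelihood_ratio_sup_le[OF assms(1), of "s * r"] assms by (simp add: mult_ac)
  qed
qed

text \<open>The constants b and c replace n * s and (n + 1) * s, so for fixed b and c the bound
  depends on s alone. Linearising the quadratic loss by exp (- u) \<ge> 1 - u makes it
  integrable.\<close>

lemma integral_t_likelihood_ratio_sup_ge:
  assumes n: "1 \<le> n" and s: "0 \<le> s" and b: "b \<le> real n * s" and c: "(real n + 1) * s \<le> c"
  shows "moment_gen_fun M b - c * s / 2 * (LINT r|M. r\<^sup>2 * exp (b * r))
           \<le> (LINT r|M. t_likelihood_ratio_sup n (s * r))"
proof -
  have "moment_gen_fun M b - c * s / 2 * (LINT r|M. r\<^sup>2 * exp (b * r))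
      = (LINT r|M. exp (b * r) - c * s / 2 * (r\<^sup>2 * exp (b * r)))"
    unfolding moment_gen_fun_def
    by (subst Bochner_Integration.integral_diff)
       (simp_all add: integrable_exp_mult integrable_square_exp_mult)
  also have "\<dots> \<le> (LINT r|M. t_likelihood_ratio_sup n (s * r))"
  proof (intro integral_mono_AE integrable_t_likelihood_ratio_sup n s Bochner_Integration.integrable_diff
      integrable_exp_mult integrable_mult_right integrable_square_exp_mult)
    show "AE r in M. exp (b * r) - c * s / 2 * (r\<^sup>2 * exp (b * r)) \<le> t_likelihood_ratio_sup n (s * r)"
      using AE_pos
    proof eventually_elim
      case (elim r)
      define u where "u = c * s / 2 * r\<^sup>2"
      \<comment> \<open>Only one of the two factors s is absorbed into c; the other one makes the
        loss O(s).\<close>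
      have "(real n + 1) * s * (s * r\<^sup>2 / 2) \<le> c * (s * r\<^sup>2 / 2)"
        using s by (intro mult_right_mono c) auto
      also have "(real n + 1) * s * (s * r\<^sup>2 / 2) = (real n + 1) * (s * r)\<^sup>2 / 2"
        by (simp add: power_mult_distrib power2_eq_square)
      finally have u: "(real n + 1) * (s * r)\<^sup>2 / 2 \<le> u" by (simp add: u_def)
      have "b * r \<le> real n * (s * r)"
        using mult_right_mono[OF b, of r] elim by (simp add: mult_ac)
      then have e: "b * r - u \<le> real n * (s * r) - (real n + 1) * (s * r)\<^sup>2 / 2"
        using u by linarith
      have "exp (b * r) * (1 + - u) \<le> exp (b * r) * exp (- u)"
        by (intro mult_left_mono exp_ge_add_one_self) simp
      also have "\<dots> = exp (b * r - u)" by (simp flip: exp_add)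
      also have "\<dots> \<le> exp (real n * (s * r) - (real n + 1) * (s * r)\<^sup>2 / 2)" using e by simp
      also have "\<dots> \<le> t_likelihood_ratio_sup n (s * r)"
        using elim s by (intro t_likelihood_ratio_sup_ge n) simp
      finally show ?case by (simp add: u_def algebra_simps)
    qed
  qed
  finally show ?thesis .
qed

text \<open>Clearing the denominators, which are positive, leaves a threshold for the integrated
  likelihood ratio, to which the bounds above apply.\<close>

lemma min_pFDR_le_iff:
  assumes "0 < \<alpha>" "0 < \<pi>" "\<pi> < 1" "1 \<le> n" "0 \<le> s"
  shows "min_pFDR \<pi> M s n \<le> \<alpha>
           \<longleftrightarrow> Q_ratio \<alpha> \<pi> \<le> (LINT r|M. t_likelihood_ratio_sup n (s * r))"
proof -
  define I where "I = (LINT r|M. t_likelihood_ratio_sup n (s * r))"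
  have "0 \<le> I"
    unfolding I_def t_likelihood_ratio_sup_eq[OF assms(4)] chi_mgf_def
    by (intro Bochner_Integration.integral_nonneg mult_nonneg_nonneg chi_square_density_nonneg) auto
  then have "0 < 1 - \<pi> + \<pi> * I" using assms by (simp add: add_pos_nonneg)
  then have "min_pFDR \<pi> M s n \<le> \<alpha> \<longleftrightarrow> 1 - \<pi> \<le> \<alpha> * (1 - \<pi> + \<pi> * I)"
    unfolding min_pFDR_def I_def by (simp add: divide_le_eq)
  also have "\<dots> \<longleftrightarrow> (1 - \<alpha>) * (1 - \<pi>) \<le> I * (\<alpha> * \<pi>)"
    by (simp add: algebra_simps)
  also have "\<dots> \<longleftrightarrow> Q_ratio \<alpha> \<pi> \<le> I"
    using assms by (simp add: Q_ratio_def divide_le_eq)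
  finally show ?thesis unfolding I_def .
qed

section \<open>Asymptotics of the minimum sample size\<close>

text \<open>Besides the upper bound, this records that the minimum is attained: \<open>LEAST\<close>
  carries information only once some sample size is known to suffice.\<close>

lemma eventually_min_sample_size_le:
  assumes \<alpha>: "0 < \<alpha>" and \<pi>: "0 < \<pi>" "\<pi> < 1"
    and b: "0 < b" "Q_ratio \<alpha> \<pi> < moment_gen_fun M b"
  shows "\<forall>\<^sub>F s in at_right 0. 1 \<le> min_sample_size \<alpha> \<pi> M s
           \<and> min_pFDR \<pi> M s (min_sample_size \<alpha> \<pi> M s) \<le> \<alpha>
           \<and> s * real (min_sample_size \<alpha> \<pi> M s) \<le> b + s"
proof -
  let ?K = "LINT r|M. r\<^sup>2 * exp (b * r)"
  \<comment> \<open>The constant b + 2 dominates (n + 1) * s: rounding up and the additional 1 cost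
    at most 2 * s, and s < 1.\<close>
  have "((\<lambda>s. moment_gen_fun M b - (b + 2) * s / 2 * ?K) \<longlongrightarrow> moment_gen_fun M b - (b + 2) * 0 / 2 * ?K)
          (at_right 0)"
    by (intro tendsto_intros) auto
  then have "\<forall>\<^sub>F s in at_right 0. Q_ratio \<alpha> \<pi> < moment_gen_fun M b - (b + 2) * s / 2 * ?K"
    by (rule order_tendstoD) (use b in simp)
  moreover have "\<forall>\<^sub>F s :: real in at_right 0. s \<in> {0<..<1}"
    by (rule eventually_at_right_real) simp
  ultimately show ?thesis
  proof eventually_elim
    case (elim s)
    define n where "n = nat \<lceil>b / s\<rceil>"
    have "0 < b / s" using b elim by simp
    then have n: "b / s \<le> real n" "real n \<le> b / s + 1" "1 \<le> n"
      unfolding n_def by linarith+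
    have bn: "b \<le> real n * s" "real n * s \<le> b + s"
      using n(1,2) elim by (auto simp: field_simps)
    moreover have "(real n + 1) * s \<le> b + 2" using bn elim by (simp add: distrib_right)
    ultimately have "Q_ratio \<alpha> \<pi> \<le> (LINT r|M. t_likelihood_ratio_sup n (s * r))"
      using integral_t_likelihood_ratio_sup_ge[of n s b "b + 2"] elim n(3) by simp
    then have *: "1 \<le> n \<and> min_pFDR \<pi> M s n \<le> \<alpha>"
      using min_pFDR_le_iff[OF \<alpha> \<pi> n(3), of s] elim n(3) by simp
    have "min_sample_size \<alpha> \<pi> M s \<le> n"
      unfolding min_sample_size_def by (rule Least_le) (rule *)
    then have "s * real (min_sample_size \<alpha> \<pi> M s) \<le> real n * s"
      using elim by (simp add: mult.commute)
    with bn LeastI[of "\<lambda>n. 1 \<le> n \<and> min_pFDR \<pi> M s n \<le> \<alpha>", OF *] show ?case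
      unfolding min_sample_size_def by linarith
  qed
qed

lemma tendsto_mult_min_sample_size:
  assumes \<alpha>: "0 < \<alpha>" and \<pi>: "0 < \<pi>" "\<pi> < 1"
    and a: "0 \<le> a" "moment_gen_fun M a = Q_ratio \<alpha> \<pi>"
  shows "((\<lambda>s. s * real (min_sample_size \<alpha> \<pi> M s)) \<longlongrightarrow> a) (at_right 0)"
proof (rule order_tendstoI)
  note small = eventually_at_right_real
  have mono: "a < b \<Longrightarrow> Q_ratio \<alpha> \<pi> < moment_gen_fun M b" for b
    using a strict_mono_onD[OF strict_mono_on_moment_gen_fun, of a b] by simp
  fix u assume u: "a < u"
  \<comment> \<open>The gap u - b absorbs the rounding error s.\<close>
  define b where "b = (a + u) / 2"
  have b: "0 < b" "a < b" "b < u" using u a by (auto simp: b_def)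
  have "\<forall>\<^sub>F s in at_right 0. s \<in> {0<..<u - b}" using b by (intro small) simp
  with eventually_min_sample_size_le[OF \<alpha> \<pi> b(1) mono[OF b(2)]]
  show "\<forall>\<^sub>F s in at_right 0. s * real (min_sample_size \<alpha> \<pi> M s) < u"
    by eventually_elim auto
next
  fix l assume l: "l < a"
  \<comment> \<open>Any point beyond a would do; the aim is that the minimum is attained for small
    s.\<close>
  have "Q_ratio \<alpha> \<pi> < moment_gen_fun M (a + 1)"
    using a strict_mono_onD[OF strict_mono_on_moment_gen_fun, of a "a + 1"] by simp
  then have "\<forall>\<^sub>F s in at_right 0. 1 \<le> min_sample_size \<alpha> \<pi> M s
           \<and> min_pFDR \<pi> M s (min_sample_size \<alpha> \<pi> M s) \<le> \<alpha>
           \<and> s * real (min_sample_size \<alpha> \<pi> M s) \<le> a + 1 + s"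
    using a by (intro eventually_min_sample_size_le \<alpha> \<pi>) auto
  moreover have "\<forall>\<^sub>F s in at_right 0. s \<in> {0<..<a - l}" using l by (intro eventually_at_right_real) simp
  ultimately show "\<forall>\<^sub>F s in at_right 0. l < s * real (min_sample_size \<alpha> \<pi> M s)"
  proof eventually_elim
    case (elim s)
    let ?n = "min_sample_size \<alpha> \<pi> M s"
    have "Q_ratio \<alpha> \<pi> \<le> moment_gen_fun M ((real ?n + 1) * s)"
      using min_pFDR_le_iff[OF \<alpha> \<pi>, of ?n s] integral_t_likelihood_ratio_sup_le[of ?n s] elim by simp
    \<comment> \<open>By contraposition: to the left of a the strictly increasing function stays
      below Q. The extra s is then smaller than a - l.\<close>
    then have "a \<le> (real ?n + 1) * s"
      using strict_mono_onD[OF strict_mono_on_moment_gen_fun, of "(real ?n + 1) * s" a] a elim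
      by (force simp: not_le[symmetric])
    then show ?case using elim by (simp add: algebra_simps)
  qed
qed

end

theorem corollary2p1:
  fixes \<alpha> \<pi> :: real and G :: "real measure"
  assumes "0 < \<alpha>" "\<alpha> < 1"
    and "0 < \<pi>" "\<pi> < 1"
    and "Q_ratio \<alpha> \<pi> > 1"
    and "real_distribution G"
    and "AE r in G. 0 < r"
    and "\<exists>l>0. integrable G (\<lambda>r. exp (l * r\<^sup>2))"
  shows "(\<lambda>s. real (min_sample_size \<alpha> \<pi> G s)) \<sim>[at_right 0]
         (\<lambda>s. 1 / s * the_inv_into {0..} (moment_gen_fun G) (Q_ratio \<alpha> \<pi>))"
proof -
  interpret subgaussian_effect_size G
    using assms by (intro subgaussian_effect_size.intro subgaussian_effect_size_axioms.intro)
  obtain a where a: "0 \<le> a" "moment_gen_fun G a = Q_ratio \<alpha> \<pi>"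
    using ex_moment_gen_fun_eq[of "Q_ratio \<alpha> \<pi>"] assms(5) by auto
  \<comment> \<open>The strict inequality Q > 1 gives a nonzero limit, so that the limit of s * n
    can be divided by a.\<close>
  have "a \<noteq> 0" using a assms(5) moment_gen_fun_0 by auto
  have inv: "the_inv_into {0..} (moment_gen_fun G) (Q_ratio \<alpha> \<pi>) = a"
    using a by (intro the_inv_into_f_eq strict_mono_on_imp_inj_on strict_mono_on_moment_gen_fun) auto
  have "((\<lambda>s. s * real (min_sample_size \<alpha> \<pi> G s) / a) \<longlongrightarrow> a / a) (at_right 0)"
    using \<open>a \<noteq> 0\<close> by (intro tendsto_divide tendsto_const tendsto_mult_min_sample_size assms a)
  then show ?thesis
    unfolding inv using \<open>a \<noteq> 0\<close> by (intro asymp_equivI') (simp add: mult.commute)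
qed

end
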